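(* An arbitrary group can be realized as a split quotient of $\mathrm{Aut}(X,\cdot)$ for some Kimura semigroup $(X,\cdot)$, with kernel isomorphic to a product of full permutation groups. That is, for every group $G$ there exist a Kimura semigroup $(X,\cdot)$ and a surjective group homomorphism $\mathrm{Aut}(X,\cdot)\to G$ admitting a right inverse group homomorphism $G\to\mathrm{Aut}(X,\cdot)$, whose kernel is isomorphic to a direct product $\prod_{i\in I}\Sigma_{C_i}$ for some family of sets $(C_i)_{i\in I}$.
   Context: A Kimura semigroup is a semigroup satisfying the identity $xyz=xz$ for all $x,y,z$. $\mathrm{Aut}(X,\cdot)$ is the group of semigroup automorphisms of $(X,\cdot)$. $\Sigma_C$ is the group of all permutations of the set $C$. Products are unrestricted direct products. *)

theory Defs
  imports "HOL-Algebra.Algebra"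
begin

text \<open>
  HOL-Algebra has no carrier-based semigroups. We reuse the record type of monoids, so that
  the library notions \<^const>\<open>hom\<close> and \<^const>\<open>AutoGroup\<close> apply; these, like the
  locales below, only refer to the carrier and the multiplication, so the unit
  component of the record plays no role.
\<close>

locale carrier_semigroup =
  fixes S (structure)
  assumes nonempty: "carrier S \<noteq> {}"
    and m_closed: "\<lbrakk>x \<in> carrier S; y \<in> carrier S\<rbrakk> \<Longrightarrow> x \<otimes> y \<in> carrier S"
    and m_assoc: "\<lbrakk>x \<in> carrier S; y \<in> carrier S; z \<in> carrier S\<rbrakk>
      \<Longrightarrow> (x \<otimes> y) \<otimes> z = x \<otimes> (y \<otimes> z)"

locale kimura_semigroup = carrier_semigroup +
  assumes kimura: "\<lbrakk>x \<in> carrier S; y \<in> carrier S; z \<in> carrier S\<rbrakk>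
      \<Longrightarrow> x \<otimes> y \<otimes> z = x \<otimes> z"

text \<open>
  The existentially quantified semigroup of the theorem needs a type that depends only on the
  type \<^typ>\<open>'a\<close> of group elements. Its elements, and the indices and the points of the
  permuted sets, are taken from \<^typ>\<open>'a list\<close>: this type is always infinite and has at
  least the cardinality of \<^typ>\<open>'a\<close>.
\<close>

end

theory Submission
  imports Defs
begin

text \<open>
  In a Kimura semigroup every product is idempotent and depends only on the squares of its
  factors, so the semigroup is a rectangular band \<open>L \<times> R\<close> (its idempotents) in which every
  element \<open>i\<close> has been inflated by a set \<open>C i\<close> of further elements whose square is \<open>i\<close>. Two
  consequences carry the theorem.

  First, the non-idempotents with a given square are indistinguishable. An automorphism that fixes
  every idempotent is an arbitrary family of permutations of the sets \<open>C i\<close>, so these automorphisms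
  form the product of the full permutation groups of the \<open>C i\<close>
  (\<open>automorphisms_fixing_products_iso\<close>).

  Second, an automorphism acts on the idempotents through a permutation \<open>\<rho>\<close> of \<open>L\<close> and a
  permutation \<open>\<gamma>\<close> of \<open>R\<close>, and it has to preserve the sizes of the sets \<open>C i\<close>. If
  these sizes are the entries \<open>m l r\<close> of a matrix of natural numbers, then the pairs
  \<open>(\<rho>, \<gamma>)\<close> that occur are exactly the symmetries of the matrix
  (\<open>auto_acts_on_coordinates\<close>, \<open>lift_auto\<close>).

  It remains to find a matrix whose group of symmetries is \<open>G\<close>. Coding the pair \<open>(g, h)\<close> by the
  entry \<open>g\<inverse> h\<close> would do this with \<open>L = R = G\<close>, but needs as many sizes as \<open>G\<close> has elements,
  and hence infinite and possibly huge cardinals when \<open>G\<close> is uncountable. Instead rows and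
  columns are indexed by \<open>G \<times> G\<close>, where the second coordinate \<open>s\<close> of a point \<open>(g, s)\<close> serves as
  the name of a generator. A well-order on \<open>G\<close> makes the names recognizable, because a
  well-order has no nontrivial automorphism, and the point \<open>(g, s)\<close> is marked against the points
  with first coordinate \<open>g s\<close>. A symmetry therefore preserves the Cayley graph of \<open>G\<close> with all its
  labels, and so is a left translation (\<open>translation_matrix_symmetry\<close>). Four entries suffice, and
  the resulting semigroup embeds into the set of lists over \<open>G\<close>. Lifting the left translations
  splits the quotient map.
\<close>

section \<open>Automorphisms of a Kimura semigroup that fix all products\<close>

lemma carrier_AutoGroup: "carrier (AutoGroup S) = auto S"
  by (simp add: AutoGroup_def)

lemma mult_AutoGroup:
  assumes "f \<in> auto S" "g \<in> auto S"
  shows "f \<otimes>\<^bsub>AutoGroup S\<^esub> g = compose (carrier S) f g"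
  using assms by (simp add: AutoGroup_def BijGroup_def auto_def)

lemma auto_mult:
  assumes "f \<in> auto S" "x \<in> carrier S" "y \<in> carrier S"
  shows "f (x \<otimes>\<^bsub>S\<^esub> y) = f x \<otimes>\<^bsub>S\<^esub> f y"
  using assms by (simp add: auto_def hom_def)

lemma auto_bij_betw: "f \<in> auto S \<Longrightarrow> bij_betw f (carrier S) (carrier S)"
  by (simp add: auto_def Bij_def)

lemma auto_extensional: "f \<in> auto S \<Longrightarrow> f \<in> extensional (carrier S)"
  by (simp add: auto_def Bij_def)

lemma auto_closed: "f \<in> auto S \<Longrightarrow> x \<in> carrier S \<Longrightarrow> f x \<in> carrier S"
  using auto_bij_betw bij_betwE by blast

context kimura_semigroup
begin

lemma mult_eq_mult_squares:
  assumes "x \<in> carrier S" "y \<in> carrier S"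
  shows "x \<otimes> y = (x \<otimes> x) \<otimes> (y \<otimes> y)"
  using kimura[of x x "y \<otimes> y"] kimura[of x y y] m_assoc[of x y y] m_closed assms by simp

lemma mult_idem:
  assumes "x \<in> carrier S" "y \<in> carrier S"
  shows "(x \<otimes> y) \<otimes> (x \<otimes> y) = x \<otimes> y"
  using kimura[of x y "x \<otimes> y"] kimura[of x x y] m_assoc[of x x y] m_closed assms by simp

text \<open>
  Products see only the squares of the factors, so any permutation that leaves all squares and
  all products in place respects the multiplication.
\<close>

lemma square_preserving_Bij_auto:
  assumes f: "f \<in> Bij (carrier S)"
    and sq: "\<And>x. x \<in> carrier S \<Longrightarrow> f x \<otimes> f x = x \<otimes> x"
    and fix_idem: "\<And>x. x \<in> carrier S \<Longrightarrow> x \<otimes> x = x \<Longrightarrow> f x = x"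
  shows "f \<in> auto S"
proof -
  have "f (x \<otimes> y) = f x \<otimes> f y" if "x \<in> carrier S" "y \<in> carrier S" for x y
  proof -
    have "f x \<in> carrier S" "f y \<in> carrier S"
      using Bij_imp_funcset[OF f] that by auto
    then have "f x \<otimes> f y = (x \<otimes> x) \<otimes> (y \<otimes> y)"
      using mult_eq_mult_squares[of "f x" "f y"] sq that by simp
    then show ?thesis
      using mult_eq_mult_squares[of x y] fix_idem[of "x \<otimes> y"] mult_idem m_closed that by simp
  qed
  then show ?thesis
    using f Bij_imp_funcset[OF f] by (simp add: auto_def hom_def)
qed

text \<open>
  The isomorphism restricts an automorphism to each of the sets \<open>C i\<close>. These sets and the set
  \<open>I\<close> of idempotents partition the semigroup, which gives injectivity; surjectivity holds because
  gluing permutations of the \<open>C i\<close> moves no square.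
\<close>

lemma automorphisms_fixing_products_iso:
  defines "C \<equiv> \<lambda>i. {x \<in> carrier S. x \<otimes> x = i \<and> x \<noteq> i}"
  defines "I \<equiv> {x \<in> carrier S. x \<otimes> x = x}"
  defines "K \<equiv> {f \<in> auto S. \<forall>i\<in>I. f i = i}"
  shows "(AutoGroup S)\<lparr>carrier := K\<rparr> \<cong> product_group I (\<lambda>i. BijGroup (C i))"
proof -
  let ?h = "\<lambda>f. \<lambda>i\<in>I. restrict f (C i)"
  have C_D: "x \<in> carrier S" "x \<otimes> x \<in> I" "x \<otimes> x = i" "x \<notin> I" if "x \<in> C i" for x i
    using that mult_idem m_closed by (auto simp: C_def I_def)
  have C_I: "x \<in> C (x \<otimes> x)" "x \<otimes> x \<in> I" if "x \<in> carrier S" "x \<notin> I" for x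
    using that mult_idem m_closed by (auto simp: C_def I_def)
  have I_D: "x \<in> carrier S" "x \<otimes> x = x" if "x \<in> I" for x
    using that by (auto simp: I_def)
  have K_D: "f \<in> auto S" "\<And>i. i \<in> I \<Longrightarrow> f i = i" if "f \<in> K" for f
    using that by (auto simp: K_def)
  have K_C: "f x \<in> C i" if f: "f \<in> K" and i: "i \<in> I" and x: "x \<in> C i" for f i x
  proof -
    have "f x \<otimes> f x = f (x \<otimes> x)"
      using auto_mult K_D(1)[OF f] C_D(1)[OF x] by metis
    then have "f x \<otimes> f x = i" using C_D[OF x] K_D[OF f] i by simp
    moreover have "f x \<noteq> i"
    proof
      assume "f x = i"
      then have "f x = f i" using K_D[OF f] i by simp
      then have "x = i"
        using auto_bij_betw[OF K_D(1)[OF f]] C_D[OF x] I_D[OF i]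
        by (auto simp: bij_betw_def dest: inj_onD)
      then show False using x by (simp add: C_def)
    qed
    ultimately show ?thesis
      using auto_closed[OF K_D(1)[OF f]] C_D[OF x] by (simp add: C_def)
  qed
  have h_Bij: "restrict f (C i) \<in> Bij (C i)" if f: "f \<in> K" and i: "i \<in> I" for f i
  proof -
    have bij: "bij_betw f (carrier S) (carrier S)"
      using auto_bij_betw[OF K_D(1)[OF f]] .
    have "C i \<subseteq> f ` C i"
    proof
      fix y assume y: "y \<in> C i"
      have "y \<in> f ` carrier S"
        using bij C_D(1)[OF y] by (simp add: bij_betw_def)
      then obtain x where x: "x \<in> carrier S" "y = f x" by blast
      have "x \<notin> I" using K_D[OF f] x C_D[OF y] by auto
      then have "x \<in> C (x \<otimes> x)" "x \<otimes> x \<in> I" using C_I x by auto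
      then have "y \<in> C (x \<otimes> x)" using K_C[OF f] x by blast
      then have "x \<otimes> x = i" using C_D(3)[OF y] C_D(3)[of y "x \<otimes> x"] by simp
      then show "y \<in> f ` C i" using \<open>x \<in> C (x \<otimes> x)\<close> x by blast
    qed
    then have "f ` C i = C i" using K_C[OF f i] by blast
    moreover have "inj_on f (C i)"
      using bij C_D(1) by (meson bij_betw_def inj_on_subset subsetI)
    ultimately show ?thesis
      by (auto simp: Bij_def bij_betw_def)
  qed
  have hom: "?h \<in> hom ((AutoGroup S)\<lparr>carrier := K\<rparr>) (product_group I (\<lambda>i. BijGroup (C i)))"
  proof (rule homI)
    fix f assume "f \<in> carrier ((AutoGroup S)\<lparr>carrier := K\<rparr>)"
    then show "?h f \<in> carrier (product_group I (\<lambda>i. BijGroup (C i)))"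
      using h_Bij by (auto simp: BijGroup_def)
  next
    fix f g
    assume "f \<in> carrier ((AutoGroup S)\<lparr>carrier := K\<rparr>)" "g \<in> carrier ((AutoGroup S)\<lparr>carrier := K\<rparr>)"
    then have fg: "f \<in> K" "g \<in> K" by auto
    have "restrict (compose (carrier S) f g) (C i)
        = compose (C i) (restrict f (C i)) (restrict g (C i))" if "i \<in> I" for i
      using K_C[OF fg(2) that] C_D(1) by (auto simp: compose_def fun_eq_iff)
    then show "?h (f \<otimes>\<^bsub>(AutoGroup S)\<lparr>carrier := K\<rparr>\<^esub> g)
        = ?h f \<otimes>\<^bsub>product_group I (\<lambda>i. BijGroup (C i))\<^esub> ?h g"
      using fg h_Bij mult_AutoGroup[OF K_D(1) K_D(1), OF fg]
      by (auto simp: BijGroup_def intro!: restrict_ext)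
  qed
  have "inj_on ?h K"
  proof (rule inj_onI)
    fix f g assume fg: "f \<in> K" "g \<in> K" and eq: "?h f = ?h g"
    have "f x = g x" if x: "x \<in> carrier S" for x
    proof (cases "x \<in> I")
      case True
      then show ?thesis using K_D(2)[OF fg(1)] K_D(2)[OF fg(2)] by simp
    next
      case False
      then have "restrict f (C (x \<otimes> x)) x = restrict g (C (x \<otimes> x)) x"
        using fun_cong[OF eq, of "x \<otimes> x"] C_I x by simp
      then show ?thesis using C_I x False by simp
    qed
    then show "f = g"
      using auto_extensional K_D(1) fg by (metis extensionalityI)
  qed
  moreover have "(\<Pi>\<^sub>E i\<in>I. Bij (C i)) \<subseteq> ?h ` K"
  proof
    fix p assume p: "p \<in> (\<Pi>\<^sub>E i\<in>I. Bij (C i))"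
    define f where "f = (\<lambda>x\<in>carrier S. if x \<in> I then x else p (x \<otimes> x) x)"
    have f_I: "f i = i" if "i \<in> I" for i
      using that I_D by (simp add: f_def)
    have f_C: "f x = p i x" if "x \<in> C i" for x i
      using C_D[OF that] by (simp add: f_def)
    have p_bij: "bij_betw (p i) (C i) (C i)" if "i \<in> I" for i
      using p that by (auto simp: Bij_def)
    have f_C_in: "f x \<in> C i" if "x \<in> C i" for x i
      using bij_betwE[OF p_bij] f_C[OF that] C_D[OF that] that by auto
    have f_outside: "f x \<in> C (x \<otimes> x)" if "x \<in> carrier S" "x \<notin> I" for x
      using f_C_in C_I that by blast
    have f_I_iff: "f x \<in> I \<longleftrightarrow> x \<in> I" if "x \<in> carrier S" for x
      using f_I C_D(4)[OF f_outside[OF that]] by (cases "x \<in> I") auto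
    have f_closed: "f x \<in> carrier S" if "x \<in> carrier S" for x
      using f_I C_D(1)[OF f_outside[OF that]] that by (cases "x \<in> I") auto
    have sq: "f x \<otimes> f x = x \<otimes> x" if "x \<in> carrier S" for x
      using f_I C_D(3)[OF f_outside[OF that]] by (cases "x \<in> I") auto
    have "carrier S \<subseteq> f ` carrier S"
    proof
      fix y assume y: "y \<in> carrier S"
      show "y \<in> f ` carrier S"
      proof (cases "y \<in> I")
        case True
        then show ?thesis using f_I y by force
      next
        case False
        have "p (y \<otimes> y) ` C (y \<otimes> y) = C (y \<otimes> y)"
          using p_bij C_I[OF y False] by (auto simp: bij_betw_def)
        then obtain x where x: "x \<in> C (y \<otimes> y)" "p (y \<otimes> y) x = y"
          using C_I(1)[OF y False] by (metis imageE)
        then have "f x = y" "x \<in> carrier S" using f_C C_D(1) by auto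
        then show ?thesis by blast
      qed
    qed
    then have "f ` carrier S = carrier S" using f_closed by blast
    moreover have "inj_on f (carrier S)"
    proof (rule inj_onI)
      fix x y assume xy: "x \<in> carrier S" "y \<in> carrier S" and eq: "f x = f y"
      have sq_eq: "x \<otimes> x = y \<otimes> y"
        using sq[OF xy(1)] sq[OF xy(2)] eq by simp
      have I_eq: "x \<in> I \<longleftrightarrow> y \<in> I"
        using f_I_iff[OF xy(1)] f_I_iff[OF xy(2)] eq by simp
      show "x = y"
      proof (cases "x \<in> I")
        case True
        then show ?thesis using f_I I_eq eq by metis
      next
        case False
        have x: "x \<in> C (x \<otimes> x)" "x \<otimes> x \<in> I" using C_I xy False by blast+
        have y: "y \<in> C (x \<otimes> x)" using C_I(1)[OF xy(2)] I_eq False sq_eq by simp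
        have "inj_on (p (x \<otimes> x)) (C (x \<otimes> x))"
          using p_bij[OF x(2)] by (simp add: bij_betw_def)
        moreover have "p (x \<otimes> x) x = p (x \<otimes> x) y"
          using f_C[OF x(1)] f_C[OF y] eq by simp
        ultimately show ?thesis using x(1) y by (rule inj_onD)
      qed
    qed
    ultimately have "f \<in> Bij (carrier S)"
      by (simp add: Bij_def bij_betw_def f_def)
    then have "f \<in> K"
      using square_preserving_Bij_auto sq f_I by (simp add: K_def I_def)
    moreover have "?h f = p"
    proof
      fix i
      show "?h f i = p i"
      proof (cases "i \<in> I")
        case True
        then have "p i \<in> extensional (C i)" using p by (auto simp: Bij_def)
        then show ?thesis
          using True f_C by (auto simp: fun_eq_iff extensional_def)
      next
        case False
        then show ?thesis using p by (auto simp: PiE_def extensional_def)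
      qed
    qed
    ultimately show "p \<in> ?h ` K" by blast
  qed
  ultimately have "bij_betw ?h K (\<Pi>\<^sub>E i\<in>I. Bij (C i))"
    using h_Bij by (auto simp: bij_betw_def)
  then show ?thesis
    using hom by (intro is_isoI isoI) (auto simp: BijGroup_def)
qed

end

section \<open>Inflated rectangular bands\<close>

text \<open>
  The rectangular band \<open>L \<times> R\<close>, with \<open>m l r\<close> additional elements squaring to \<open>(l, r)\<close>. The
  element with number \<open>0\<close> is the idempotent, so there are \<open>m l r + 1\<close> elements over \<open>(l, r)\<close>. The
  coding function \<open>e\<close> allows the semigroup to live on any type that is large enough.
\<close>

definition inflated_band ::
    "('l \<times> 'r \<times> nat \<Rightarrow> 'x) \<Rightarrow> 'l set \<Rightarrow> 'r set \<Rightarrow> ('l \<Rightarrow> 'r \<Rightarrow> nat) \<Rightarrow> 'x monoid" where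
  "inflated_band e L R m =
    \<lparr>carrier = {e (l, r, k) |l r k. l \<in> L \<and> r \<in> R \<and> k \<le> m l r},
     monoid.mult = \<lambda>x y. e (fst (the_inv e x), fst (snd (the_inv e y)), 0),
     one = undefined\<rparr>"

locale inflation =
  fixes e :: "'l \<times> 'r \<times> nat \<Rightarrow> 'x" and L :: "'l set" and R :: "'r set"
    and m :: "'l \<Rightarrow> 'r \<Rightarrow> nat"
  assumes inj_e: "inj e" and L_nonempty: "L \<noteq> {}" and R_nonempty: "R \<noteq> {}"
begin

abbreviation B where "B \<equiv> inflated_band e L R m"

lemma the_inv_e [simp]: "the_inv e (e p) = p"
  using inj_e by (rule the_inv_f_f)

lemma mem_carrier [simp]:
  "e (l, r, k) \<in> carrier B \<longleftrightarrow> l \<in> L \<and> r \<in> R \<and> k \<le> m l r"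
  using inj_e by (auto simp: inflated_band_def dest: injD)

lemma carrier_cases:
  assumes "x \<in> carrier B"
  obtains l r k where "x = e (l, r, k)" "l \<in> L" "r \<in> R" "k \<le> m l r"
  using assms by (auto simp: inflated_band_def)

lemma mult_e [simp]: "e (l, r, k) \<otimes>\<^bsub>B\<^esub> e (l', r', k') = e (l, r', 0)"
  using inj_e by (simp add: inflated_band_def)

lemma e_eq_iff [simp]: "e p = e q \<longleftrightarrow> p = q"
  using inj_e by (auto dest: injD)

lemma kimura_semigroup_inflated_band: "kimura_semigroup B"
proof
  show "carrier B \<noteq> {}"
    using L_nonempty R_nonempty by (force simp: inflated_band_def)
qed (auto elim!: carrier_cases)

lemma idempotents: "{x \<in> carrier B. x \<otimes>\<^bsub>B\<^esub> x = x} = {e (l, r, 0) |l r. l \<in> L \<and> r \<in> R}"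
  by (auto elim!: carrier_cases)

text \<open>
  The image of \<open>(l, r) = (l, r0) (l0, r)\<close> is determined by the row of the image of \<open>(l, r0)\<close> and
  the column of the image of \<open>(l0, r)\<close>; this defines \<open>\<rho>\<close> and \<open>\<gamma>\<close>. The elements over \<open>(l, r)\<close> are
  those whose square is \<open>(l, r)\<close>, so they are mapped bijectively to the elements over
  \<open>(\<rho> l, \<gamma> r)\<close>, and counting gives the invariance of \<open>m\<close>.
\<close>

lemma auto_acts_on_coordinates:
  assumes f: "f \<in> auto B"
  obtains \<rho> \<gamma> where "bij_betw \<rho> L L" "bij_betw \<gamma> R R"
    "\<And>l r. l \<in> L \<Longrightarrow> r \<in> R \<Longrightarrow> m (\<rho> l) (\<gamma> r) = m l r"
    "\<And>l r. l \<in> L \<Longrightarrow> r \<in> R \<Longrightarrow> f (e (l, r, 0)) = e (\<rho> l, \<gamma> r, 0)"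
proof -
  obtain l0 r0 where l0: "l0 \<in> L" and r0: "r0 \<in> R"
    using L_nonempty R_nonempty by blast
  define \<rho> where "\<rho> l = fst (the_inv e (f (e (l, r0, 0))))" for l
  define \<gamma> where "\<gamma> r = fst (snd (the_inv e (f (e (l0, r, 0)))))" for r
  have f_ex: "\<exists>l' \<in> L. \<exists>r' \<in> R. \<exists>k' \<le> m l' r'. f (e (l, r, k)) = e (l', r', k')"
    if "l \<in> L" "r \<in> R" "k \<le> m l r" for l r k
    using auto_closed[OF f, of "e (l, r, k)"] that by (auto elim: carrier_cases)
  have f_0: "f (e (l, r, 0)) = e (\<rho> l, \<gamma> r, 0)" if "l \<in> L" "r \<in> R" for l r
  proof -
    have "f (e (l, r, 0)) = f (e (l, r0, 0)) \<otimes>\<^bsub>B\<^esub> f (e (l0, r, 0))"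
      using auto_mult[OF f, of "e (l, r0, 0)" "e (l0, r, 0)"] that l0 r0 by simp
    then show ?thesis
      by (simp add: inflated_band_def \<rho>_def \<gamma>_def)
  qed
  have f_e: "\<exists>k' \<le> m (\<rho> l) (\<gamma> r). f (e (l, r, k)) = e (\<rho> l, \<gamma> r, k')"
    if lrk: "l \<in> L" "r \<in> R" "k \<le> m l r" for l r k
  proof -
    have "f (e (l, r, k)) \<otimes>\<^bsub>B\<^esub> f (e (l, r, k)) = e (\<rho> l, \<gamma> r, 0)"
      using auto_mult[OF f, of "e (l, r, k)" "e (l, r, k)"] f_0 lrk by simp
    then show ?thesis using f_ex[OF lrk] by auto
  qed
  have \<rho>_in: "\<rho> l \<in> L" if "l \<in> L" for l
    using f_0[OF that r0] f_ex[OF that r0] by fastforce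
  have \<gamma>_in: "\<gamma> r \<in> R" if "r \<in> R" for r
    using f_0[OF l0 that] f_ex[OF l0 that] by fastforce
  have bij: "bij_betw f (carrier B) (carrier B)"
    using auto_bij_betw[OF f] .
  have f_inj: "x = y" if "f x = f y" "x \<in> carrier B" "y \<in> carrier B" for x y
    using that bij by (auto simp: bij_betw_def dest: inj_onD)
  have f_surj: "\<exists>l' \<in> L. \<exists>r' \<in> R. \<exists>k' \<le> m l' r'. e (l, r, k) = f (e (l', r', k'))"
    if "l \<in> L" "r \<in> R" "k \<le> m l r" for l r k
  proof -
    have "e (l, r, k) \<in> f ` carrier B"
      using that bij by (simp add: bij_betw_def)
    then show ?thesis by (auto elim!: carrier_cases)
  qed
  have \<rho>_inj: "l = l'" if "\<rho> l = \<rho> l'" "l \<in> L" "l' \<in> L" for l l'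
    using f_inj[of "e (l, r0, 0)" "e (l', r0, 0)"] f_0 that r0 by simp
  have \<gamma>_inj: "r = r'" if "\<gamma> r = \<gamma> r'" "r \<in> R" "r' \<in> R" for r r'
    using f_inj[of "e (l0, r, 0)" "e (l0, r', 0)"] f_0 that l0 by simp
  have "L \<subseteq> \<rho> ` L"
  proof
    fix l assume "l \<in> L"
    then obtain l' r' k' where "l' \<in> L" "r' \<in> R" "k' \<le> m l' r'" "e (l, r0, 0) = f (e (l', r', k'))"
      using f_surj[of l r0 0] r0 by auto
    then show "l \<in> \<rho> ` L" using f_e[of l' r' k'] by auto
  qed
  then have "bij_betw \<rho> L L"
    using \<rho>_in \<rho>_inj by (auto simp: bij_betw_def inj_on_def)
  moreover have "R \<subseteq> \<gamma> ` R"
  proof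
    fix r assume "r \<in> R"
    then obtain l' r' k' where "l' \<in> L" "r' \<in> R" "k' \<le> m l' r'" "e (l0, r, 0) = f (e (l', r', k'))"
      using f_surj[of l0 r 0] l0 by auto
    then show "r \<in> \<gamma> ` R" using f_e[of l' r' k'] by auto
  qed
  then have "bij_betw \<gamma> R R"
    using \<gamma>_in \<gamma>_inj by (auto simp: bij_betw_def inj_on_def)
  moreover have "m (\<rho> l) (\<gamma> r) = m l r" if lr: "l \<in> L" "r \<in> R" for l r
  proof -
    let ?F = "\<lambda>l r. (\<lambda>k. e (l, r, k)) ` {..m l r}"
    have card_F: "card (?F l r) = Suc (m l r)" for l r
      by (subst card_image) (auto simp: inj_on_def)
    have "?F (\<rho> l) (\<gamma> r) \<subseteq> f ` ?F l r"
    proof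
      fix y assume "y \<in> ?F (\<rho> l) (\<gamma> r)"
      then obtain k where k: "k \<le> m (\<rho> l) (\<gamma> r)" "y = e (\<rho> l, \<gamma> r, k)" by auto
      then obtain l' r' k' where
        *: "l' \<in> L" "r' \<in> R" "k' \<le> m l' r'" "e (\<rho> l, \<gamma> r, k) = f (e (l', r', k'))"
        using f_surj \<rho>_in \<gamma>_in lr by metis
      then have "\<rho> l = \<rho> l'" "\<gamma> r = \<gamma> r'" using f_e by fastforce+
      then have "l = l'" "r = r'" using \<rho>_inj \<gamma>_inj lr * by auto
      then show "y \<in> f ` ?F l r" using k * by auto
    qed
    moreover have "f ` ?F l r \<subseteq> ?F (\<rho> l) (\<gamma> r)"
      using f_e lr by fastforce
    moreover have "inj_on f (?F l r)"
    proof (rule inj_onI)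
      fix x y assume "x \<in> ?F l r" "y \<in> ?F l r" "f x = f y"
      moreover from this have "x \<in> carrier B" "y \<in> carrier B" using lr by auto
      ultimately show "x = y" using f_inj by blast
    qed
    ultimately have "card (?F (\<rho> l) (\<gamma> r)) = card (?F l r)"
      by (metis card_image subset_antisym)
    then show ?thesis by (simp add: card_F)
  qed
  ultimately show thesis using that f_0 by blast
qed

definition lift :: "('l \<Rightarrow> 'l) \<Rightarrow> ('r \<Rightarrow> 'r) \<Rightarrow> 'x \<Rightarrow> 'x" where
  "lift \<rho> \<gamma> = (\<lambda>x\<in>carrier B. case the_inv e x of (l, r, k) \<Rightarrow> e (\<rho> l, \<gamma> r, k))"

lemma lift_e:
  "l \<in> L \<Longrightarrow> r \<in> R \<Longrightarrow> k \<le> m l r \<Longrightarrow> lift \<rho> \<gamma> (e (l, r, k)) = e (\<rho> l, \<gamma> r, k)"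
  using inj_e by (simp add: lift_def)

lemma lift_auto:
  assumes \<rho>: "bij_betw \<rho> L L" and \<gamma>: "bij_betw \<gamma> R R"
    and m: "\<And>l r. l \<in> L \<Longrightarrow> r \<in> R \<Longrightarrow> m (\<rho> l) (\<gamma> r) = m l r"
  shows "lift \<rho> \<gamma> \<in> auto B"
proof -
  have in_\<rho>\<gamma>: "\<rho> l \<in> L" "\<gamma> r \<in> R" if "l \<in> L" "r \<in> R" for l r
    using that \<rho> \<gamma> bij_betwE by auto
  have closed: "lift \<rho> \<gamma> x \<in> carrier B" if "x \<in> carrier B" for x
    using that in_\<rho>\<gamma> m by (auto elim!: carrier_cases simp: lift_e)
  have "carrier B \<subseteq> lift \<rho> \<gamma> ` carrier B"
  proof
    fix y assume "y \<in> carrier B"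
    then obtain l r k where y: "y = e (l, r, k)" "l \<in> L" "r \<in> R" "k \<le> m l r"
      by (rule carrier_cases)
    then obtain l' r' where lr': "l' \<in> L" "r' \<in> R" "l = \<rho> l'" "r = \<gamma> r'"
      using \<rho> \<gamma> by (metis bij_betw_imp_surj_on imageE)
    then have "y = lift \<rho> \<gamma> (e (l', r', k))" "e (l', r', k) \<in> carrier B"
      using y m by (auto simp: lift_e)
    then show "y \<in> lift \<rho> \<gamma> ` carrier B" by blast
  qed
  then have "lift \<rho> \<gamma> ` carrier B = carrier B" using closed by blast
  moreover have "inj_on (lift \<rho> \<gamma>) (carrier B)"
    using \<rho> \<gamma> by (auto intro!: inj_onI elim!: carrier_cases simp: lift_e bij_betw_def
        dest: inj_onD)
  ultimately have "lift \<rho> \<gamma> \<in> Bij (carrier B)"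
    by (simp add: Bij_def bij_betw_def lift_def)
  moreover have "lift \<rho> \<gamma> \<in> hom B B"
    using closed by (intro homI) (auto elim!: carrier_cases simp: lift_e)
  ultimately show ?thesis by (simp add: auto_def)
qed

lemma compose_lift:
  assumes "bij_betw \<rho>' L L" "bij_betw \<gamma>' R R"
    and "\<And>l r. l \<in> L \<Longrightarrow> r \<in> R \<Longrightarrow> m (\<rho>' l) (\<gamma>' r) = m l r"
  shows "compose (carrier B) (lift \<rho> \<gamma>) (lift \<rho>' \<gamma>') = lift (\<rho> \<circ> \<rho>') (\<gamma> \<circ> \<gamma>')"
proof (rule extensionalityI[of _ "carrier B"])
  fix x assume x: "x \<in> carrier B"
  have "\<rho>' l \<in> L" "\<gamma>' r \<in> R" if "l \<in> L" "r \<in> R" for l r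
    using that assms(1,2) bij_betwE by auto
  then show "compose (carrier B) (lift \<rho> \<gamma>) (lift \<rho>' \<gamma>') x = lift (\<rho> \<circ> \<rho>') (\<gamma> \<circ> \<gamma>') x"
    using x assms(3) by (auto elim!: carrier_cases simp: lift_e compose_def)
qed (auto simp: lift_def)

end

section \<open>A matrix whose symmetries are the translations of a group\<close>

text \<open>
  If \<open>s\<close> is minimal with \<open>f s \<noteq> s\<close>, then everything below \<open>s\<close> is fixed. So \<open>f s\<close> cannot lie below
  \<open>s\<close> by injectivity; and if it lies above, then the preimage of \<open>s\<close> lies below \<open>s\<close> and is fixed,
  again a contradiction.
\<close>

lemma wellfounded_total_rigid:
  assumes wf: "wf r" and total: "total_on A r" and bij: "bij_betw f A A"
    and iff: "\<And>s t. s \<in> A \<Longrightarrow> t \<in> A \<Longrightarrow> (f s, f t) \<in> r \<longleftrightarrow> (s, t) \<in> r"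
    and "s \<in> A"
  shows "f s = s"
  using wf \<open>s \<in> A\<close>
proof (induction s rule: wf_induct_rule)
  case (less s)
  have f_in: "f s \<in> A" using less.prems bij bij_betwE by blast
  have f_inj: "u = v" if "f u = f v" "u \<in> A" "v \<in> A" for u v
    using that bij by (auto simp: bij_betw_def dest: inj_onD)
  show ?case
  proof (rule ccontr)
    assume ne: "f s \<noteq> s"
    then consider "(f s, s) \<in> r" | "(s, f s) \<in> r"
      using total f_in less.prems by (auto simp: total_on_def)
    then show False
    proof cases
      case 1
      then have "f (f s) = f s" using less.IH f_in by blast
      then show False using f_inj f_in less.prems ne by metis
    next
      case 2
      obtain u where u: "u \<in> A" "f u = s"
        using less.prems bij by (metis bij_betw_imp_surj_on imageE)
      then have "(u, s) \<in> r" using 2 iff less.prems by metis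
      then show False using less.IH u ne by metis
    qed
  qed
qed

text \<open>
  Each entry below \<open>3\<close> encodes one relation that a symmetry must respect. The entry \<open>0\<close> matches
  every row with the column of the same name, so that both are permuted alike. The entry \<open>1\<close>
  describes a strict order, to be chosen rigid, on the points over the same group element. The entry
  \<open>2\<close> draws the Cayley graph: for \<open>s \<noteq> \<one>\<close>, it joins \<open>(g, s)\<close> to all points with first coordinate
  \<open>g s\<close>. The entry \<open>3\<close> is for all other pairs.
\<close>

definition translation_matrix ::
    "('a, 'b) monoid_scheme \<Rightarrow> 'a rel \<Rightarrow> 'a \<times> 'a \<Rightarrow> 'a \<times> 'a \<Rightarrow> nat" where
  "translation_matrix G r = (\<lambda>(g, s) (h, t).
    if g = h then if s = t then 0 else if (s, t) \<in> r then 1 else 3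
    else if h = g \<otimes>\<^bsub>G\<^esub> s then 2 else 3)"

lemma (in group) translation_matrix_translate:
  assumes "a \<in> carrier G" "g \<in> carrier G" "s \<in> carrier G" "h \<in> carrier G"
  shows "translation_matrix G r (a \<otimes> g, s) (a \<otimes> h, t) = translation_matrix G r (g, s) (h, t)"
  using assms by (auto simp: translation_matrix_def m_assoc)

text \<open>
  The entries \<open>0\<close> and \<open>1\<close> show that a symmetry permutes the classes of points with the same first
  coordinate; rigidity of the order then shows that it fixes the second coordinates. So it has
  the form \<open>(g, s) \<mapsto> (\<pi> g, s)\<close>, and the entry \<open>2\<close> forces \<open>\<pi> (g s) = \<pi> g s\<close>, which makes
  \<open>\<pi>\<close> the left translation by \<open>\<pi> \<one>\<close>.
\<close>

lemma (in group) translation_matrix_symmetry: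
  fixes r :: "'a rel"
  assumes r: "wf r" "total_on (carrier G) r"
    and \<rho>: "bij_betw \<rho> (carrier G \<times> carrier G) (carrier G \<times> carrier G)"
    and \<gamma>: "bij_betw \<gamma> (carrier G \<times> carrier G) (carrier G \<times> carrier G)"
    and sym: "\<And>x y. x \<in> carrier G \<times> carrier G \<Longrightarrow> y \<in> carrier G \<times> carrier G
      \<Longrightarrow> translation_matrix G r (\<rho> x) (\<gamma> y) = translation_matrix G r x y"
  obtains a where "a \<in> carrier G"
    "\<And>g s. g \<in> carrier G \<Longrightarrow> s \<in> carrier G \<Longrightarrow> \<rho> (g, s) = (a \<otimes> g, s)"
    "\<And>g s. g \<in> carrier G \<Longrightarrow> s \<in> carrier G \<Longrightarrow> \<gamma> (g, s) = (a \<otimes> g, s)"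
proof -
  let ?V = "carrier G \<times> carrier G"
  let ?m = "translation_matrix G r"
  have m_0: "?m x y = 0 \<longleftrightarrow> x = y" for x y
    by (auto simp: translation_matrix_def split: prod.splits)
  have m_1: "?m x y = 1 \<longleftrightarrow> fst x = fst y \<and> snd x \<noteq> snd y \<and> (snd x, snd y) \<in> r" for x y
    by (auto simp: translation_matrix_def split: prod.splits)
  have m_2: "?m x y = 2 \<longleftrightarrow> fst x \<noteq> fst y \<and> fst y = fst x \<otimes> snd x" for x y
    by (auto simp: translation_matrix_def split: prod.splits)
  have \<gamma>_eq: "\<gamma> x = \<rho> x" if "x \<in> ?V" for x
    using sym[OF that that] m_0[of x x] m_0[of "\<rho> x" "\<gamma> x"] by simp
  have sym': "?m (\<rho> x) (\<rho> y) = ?m x y" if "x \<in> ?V" "y \<in> ?V" for x y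
    using sym[OF that] \<gamma>_eq[OF that(2)] by simp
  have \<rho>_in: "\<rho> x \<in> ?V" if "x \<in> ?V" for x
    using that \<rho> bij_betwE by blast
  have \<rho>_inj: "x = y" if "\<rho> x = \<rho> y" "x \<in> ?V" "y \<in> ?V" for x y
    using that \<rho> by (auto simp: bij_betw_def dest: inj_onD)
  have same_fst: "fst x = fst y \<longleftrightarrow> ?m x y = 0 \<or> ?m x y = 1 \<or> ?m y x = 1"
    if "x \<in> ?V" "y \<in> ?V" for x y
  proof -
    have "snd x = snd y \<or> (snd x, snd y) \<in> r \<or> (snd y, snd x) \<in> r"
    proof -
      have "snd x \<in> carrier G" "snd y \<in> carrier G" using that by auto
      then show ?thesis using r(2) unfolding total_on_def by blast
    qed
    then show ?thesis
      using m_0[of x y] m_1[of x y] m_1[of y x] prod_eq_iff[of x y] by metis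
  qed
  have \<rho>_fst: "fst (\<rho> x) = fst (\<rho> y) \<longleftrightarrow> fst x = fst y" if "x \<in> ?V" "y \<in> ?V" for x y
    using same_fst[OF that] same_fst[OF \<rho>_in \<rho>_in, OF that] sym'[OF that] sym'[OF that(2,1)]
    by simp
  \<comment> \<open>By the previous fact the choice of the second coordinate does not matter here.\<close>
  define \<pi> where "\<pi> g = fst (\<rho> (g, \<one>))" for g
  have \<pi>_in: "\<pi> g \<in> carrier G" if "g \<in> carrier G" for g
    using \<rho>_in[of "(g, \<one>)"] that by (auto simp: \<pi>_def)
  have \<rho>_\<pi>: "\<rho> (g, s) = (\<pi> g, s)" if g: "g \<in> carrier G" and s: "s \<in> carrier G" for g s
  proof -
    define f where "f s = snd (\<rho> (g, s))" for s
    have \<rho>_f: "\<rho> (g, s) = (\<pi> g, f s)" if "s \<in> carrier G" for s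
      using \<rho>_fst[of "(g, s)" "(g, \<one>)"] g that by (simp add: \<pi>_def f_def prod_eq_iff)
    have f_in: "f s \<in> carrier G" if "s \<in> carrier G" for s
      using \<rho>_in[of "(g, s)"] g that by (auto simp: f_def)
    have f_inj: "s = t" if "f s = f t" "s \<in> carrier G" "t \<in> carrier G" for s t
      using \<rho>_inj[of "(g, s)" "(g, t)"] \<rho>_f that g by simp
    have "carrier G \<subseteq> f ` carrier G"
    proof
      fix t assume t: "t \<in> carrier G"
      then have "(\<pi> g, t) \<in> \<rho> ` ?V"
        using \<pi>_in g \<rho> by (simp add: bij_betw_def)
      then obtain h s where hs: "h \<in> carrier G" "s \<in> carrier G" "\<rho> (h, s) = (\<pi> g, t)"
        by auto
      then have "h = g" using \<rho>_fst[of "(h, s)" "(g, \<one>)"] g by (simp add: \<pi>_def)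
      then show "t \<in> f ` carrier G" using hs \<rho>_f by auto
    qed
    then have "bij_betw f (carrier G) (carrier G)"
      using f_in f_inj by (auto simp: bij_betw_def inj_on_def)
    moreover have "(f s, f t) \<in> r \<longleftrightarrow> (s, t) \<in> r" if "s \<in> carrier G" "t \<in> carrier G" for s t
    proof (cases "s = t")
      case True
      then show ?thesis using wf_not_refl[OF r(1)] by simp
    next
      case False
      have "?m (\<rho> (g, s)) (\<rho> (g, t)) = 1 \<longleftrightarrow> ?m (g, s) (g, t) = 1"
        using sym' that g by simp
      then show ?thesis
        using False f_inj[OF _ that] \<rho>_f[OF that(1)] \<rho>_f[OF that(2)] unfolding m_1 by auto
    qed
    ultimately have "f s = s"
      using wellfounded_total_rigid[OF r] s by blast
    then show ?thesis using \<rho>_f s by simp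
  qed
  have \<pi>_mult: "\<pi> (g \<otimes> s) = \<pi> g \<otimes> s" if g: "g \<in> carrier G" and s: "s \<in> carrier G" for g s
  proof (cases "s = \<one>")
    \<comment> \<open>The entry \<open>2\<close> never occurs over a single group element, so \<open>s = \<one>\<close> is separate.\<close>
    case True
    then show ?thesis using g \<pi>_in by simp
  next
    case False
    then have "g \<noteq> g \<otimes> s" using g s by simp
    then have "?m (g, s) (g \<otimes> s, \<one>) = 2" using m_2 by simp
    then have "?m (\<pi> g, s) (\<pi> (g \<otimes> s), \<one>) = 2"
      using sym'[of "(g, s)" "(g \<otimes> s, \<one>)"] \<rho>_\<pi> g s by simp
    then show ?thesis using m_2 by simp
  qed
  have \<rho>_translate: "\<rho> (g, s) = (\<pi> \<one> \<otimes> g, s)" if "g \<in> carrier G" "s \<in> carrier G" for g s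
    using \<pi>_mult[of \<one> g] \<rho>_\<pi> that by simp
  show thesis
  proof (rule that)
    show "\<pi> \<one> \<in> carrier G" by (simp add: \<pi>_in)
  qed (simp_all add: \<gamma>_eq \<rho>_translate)
qed

section \<open>Realizing an arbitrary group\<close>

text \<open>
  The number \<open>k\<close> is coded in unary by the length of the list; the repeated letter is arbitrary.
\<close>

definition list_code :: "('a \<times> 'a) \<times> ('a \<times> 'a) \<times> nat \<Rightarrow> 'a list" where
  "list_code = (\<lambda>((g, s), (h, t), k). [g, s, h, t] @ replicate k g)"

lemma inj_list_code: "inj list_code"
proof (rule injI)
  fix p q :: "('a \<times> 'a) \<times> ('a \<times> 'a) \<times> nat"
  assume eq: "list_code p = list_code q"
  obtain g s h t k where p: "p = ((g, s), (h, t), k)" by (metis prod.exhaust)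
  obtain g' s' h' t' k' where q: "q = ((g', s'), (h', t'), k')" by (metis prod.exhaust)
  from arg_cong[OF eq, of length] eq show "p = q"
    by (simp add: p q list_code_def)
qed

theorem theorem7:
  fixes G :: "('a, 'b) monoid_scheme"
  assumes "group G"
  shows "\<exists>(S :: 'a list monoid) \<phi> \<psi> (I :: 'a list set) (C :: 'a list \<Rightarrow> 'a list set).
    kimura_semigroup S \<and>
    \<phi> \<in> epi (AutoGroup S) G \<and>
    \<psi> \<in> hom G (AutoGroup S) \<and>
    (\<forall>g \<in> carrier G. \<phi> (\<psi> g) = g) \<and>
    (AutoGroup S)\<lparr>carrier := kernel (AutoGroup S) G \<phi>\<rparr>
      \<cong> product_group I (\<lambda>i. BijGroup (C i))"
proof -
  interpret G: group G by fact
  let ?A = "carrier G"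
  let ?V = "?A \<times> ?A"
  obtain w where w: "well_order_on ?A w" using well_order_on by blast
  define r where "r = w - Id"
  have r: "wf r" "total_on ?A r"
    using w by (auto simp: r_def well_order_on_def linear_order_on_def total_on_def)
  define m where "m = translation_matrix G r"
  interpret inflation "list_code :: ('a \<times> 'a) \<times> ('a \<times> 'a) \<times> nat \<Rightarrow> 'a list" ?V ?V m
    using inj_list_code by unfold_locales auto
  interpret B: kimura_semigroup B by (rule kimura_semigroup_inflated_band)
  let ?o = "(\<one>\<^bsub>G\<^esub>, \<one>\<^bsub>G\<^esub>)"
  \<comment> \<open>All automorphisms turn out to act on the band as left translations, so the translating
    element can be read off from the image of the idempotent with all coordinates \<open>\<one>\<close>.\<close>
  define \<phi> where "\<phi> f = fst (fst (the_inv list_code (f (list_code (?o, ?o, 0)))))"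
    for f :: "'a list \<Rightarrow> 'a list"
  \<comment> \<open>\<open>\<psi>\<close> translates the first coordinates and keeps the number of each element in its fibre,
    which makes it multiplicative.\<close>
  define \<tau> where "\<tau> a = map_prod ((\<otimes>\<^bsub>G\<^esub>) a) (id :: 'a \<Rightarrow> 'a)" for a
  define \<psi> where "\<psi> a = lift (\<tau> a) (\<tau> a)" for a
  have \<phi>: "\<phi> f \<in> ?A \<and> (\<forall>x\<in>?V. \<forall>y\<in>?V. f (list_code (x, y, 0)) = list_code (\<tau> (\<phi> f) x, \<tau> (\<phi> f) y, 0))"
    if f: "f \<in> auto B" for f
  proof -
    obtain \<rho> \<gamma> where \<rho>\<gamma>: "bij_betw \<rho> ?V ?V" "bij_betw \<gamma> ?V ?V"
      "\<And>x y. x \<in> ?V \<Longrightarrow> y \<in> ?V \<Longrightarrow> m (\<rho> x) (\<gamma> y) = m x y"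
      and f_e: "\<And>x y. x \<in> ?V \<Longrightarrow> y \<in> ?V \<Longrightarrow> f (list_code (x, y, 0)) = list_code (\<rho> x, \<gamma> y, 0)"
      using auto_acts_on_coordinates[OF f] by metis
    obtain a where a: "a \<in> ?A"
      "\<And>g s. g \<in> ?A \<Longrightarrow> s \<in> ?A \<Longrightarrow> \<rho> (g, s) = (a \<otimes>\<^bsub>G\<^esub> g, s)"
      "\<And>g s. g \<in> ?A \<Longrightarrow> s \<in> ?A \<Longrightarrow> \<gamma> (g, s) = (a \<otimes>\<^bsub>G\<^esub> g, s)"
      using G.translation_matrix_symmetry[OF r \<rho>\<gamma>(1,2)] \<rho>\<gamma>(3) unfolding m_def by metis
    have "\<phi> f = a"
      using f_e[of ?o ?o] a inj_list_code by (simp add: \<phi>_def)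
    then show ?thesis using f_e a by (auto simp: \<tau>_def)
  qed
  have \<tau>_bij: "bij_betw (\<tau> a) ?V ?V" if "a \<in> ?A" for a
  proof -
    have "bij_betw ((\<otimes>\<^bsub>G\<^esub>) a) ?A ?A"
      using that by (auto simp: bij_betw_def G.inj_on_cmult G.surj_const_mult)
    then show ?thesis
      unfolding \<tau>_def by (intro bij_betw_map_prod) (auto simp: bij_betw_def)
  qed
  have \<tau>_m: "m (\<tau> a x) (\<tau> a y) = m x y" if "a \<in> ?A" "x \<in> ?V" "y \<in> ?V" for a x y
    using that by (auto simp: \<tau>_def m_def G.translation_matrix_translate)
  have \<psi>_auto: "\<psi> a \<in> auto B" if "a \<in> ?A" for a
    unfolding \<psi>_def using lift_auto \<tau>_bij \<tau>_m that by simp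
  have \<phi>\<psi>: "\<phi> (\<psi> a) = a" if "a \<in> ?A" for a
    using that inj_list_code by (simp add: \<phi>_def \<psi>_def lift_e \<tau>_def)
  have \<phi>_hom: "\<phi> \<in> hom (AutoGroup B) G"
  proof (rule homI)
    fix f g assume "f \<in> carrier (AutoGroup B)" "g \<in> carrier (AutoGroup B)"
    then have fg: "f \<in> auto B" "g \<in> auto B" by (simp_all add: carrier_AutoGroup)
    have "f (g (list_code (?o, ?o, 0))) = list_code (\<tau> (\<phi> f) (\<tau> (\<phi> g) ?o), \<tau> (\<phi> f) (\<tau> (\<phi> g) ?o), 0)"
      using \<phi>[OF fg(1)] \<phi>[OF fg(2)] by (auto simp: \<tau>_def)
    moreover have "\<phi> (compose (carrier B) f g)
        = fst (fst (the_inv list_code (f (g (list_code (?o, ?o, 0))))))"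
      by (simp add: \<phi>_def compose_def)
    ultimately have "\<phi> (compose (carrier B) f g) = \<phi> f \<otimes>\<^bsub>G\<^esub> \<phi> g"
      using \<phi>[OF fg(1)] \<phi>[OF fg(2)] by (simp add: \<tau>_def)
    then show "\<phi> (f \<otimes>\<^bsub>AutoGroup B\<^esub> g) = \<phi> f \<otimes>\<^bsub>G\<^esub> \<phi> g"
      using fg by (simp add: mult_AutoGroup)
  qed (simp add: carrier_AutoGroup \<phi>)
  have \<phi>_epi: "\<phi> \<in> epi (AutoGroup B) G"
    unfolding epi_iff_subset carrier_AutoGroup
    using \<phi>_hom \<psi>_auto \<phi>\<psi> by (metis image_eqI subsetI)
  have \<psi>_hom: "\<psi> \<in> hom G (AutoGroup B)"
  proof (rule homI)
    fix a b assume ab: "a \<in> ?A" "b \<in> ?A"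
    have "\<psi> (a \<otimes>\<^bsub>G\<^esub> b) = lift (\<tau> a \<circ> \<tau> b) (\<tau> a \<circ> \<tau> b)"
    proof (rule extensionalityI[of _ "carrier B"])
      fix x assume "x \<in> carrier B"
      then show "\<psi> (a \<otimes>\<^bsub>G\<^esub> b) x = lift (\<tau> a \<circ> \<tau> b) (\<tau> a \<circ> \<tau> b) x"
        using ab by (auto elim!: carrier_cases simp: \<psi>_def lift_e \<tau>_def G.m_assoc)
    qed (auto simp: \<psi>_def lift_def)
    then show "\<psi> (a \<otimes>\<^bsub>G\<^esub> b) = \<psi> a \<otimes>\<^bsub>AutoGroup B\<^esub> \<psi> b"
      using ab compose_lift[OF \<tau>_bij \<tau>_bij \<tau>_m, of b] \<psi>_auto
      by (simp add: mult_AutoGroup) (simp add: \<psi>_def)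
  qed (simp add: carrier_AutoGroup \<psi>_auto)
  let ?I = "{x \<in> carrier B. x \<otimes>\<^bsub>B\<^esub> x = x}"
  let ?C = "\<lambda>i. {x \<in> carrier B. x \<otimes>\<^bsub>B\<^esub> x = i \<and> x \<noteq> i}"
  have "kernel (AutoGroup B) G \<phi> = {f \<in> auto B. \<forall>i\<in>?I. f i = i}"
  proof -
    have "\<phi> f = \<one>\<^bsub>G\<^esub> \<longleftrightarrow> (\<forall>i\<in>?I. f i = i)" if f: "f \<in> auto B" for f
    proof
      assume "\<phi> f = \<one>\<^bsub>G\<^esub>"
      then show "\<forall>i\<in>?I. f i = i"
        unfolding idempotents using \<phi>[OF f] by (auto simp: \<tau>_def)
    next
      assume "\<forall>i\<in>?I. f i = i"
      then have "f (list_code (?o, ?o, 0)) = list_code (?o, ?o, 0)" by simp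
      then show "\<phi> f = \<one>\<^bsub>G\<^esub>" using inj_list_code by (simp add: \<phi>_def)
    qed
    then show ?thesis by (auto simp: kernel_def carrier_AutoGroup)
  qed
  then have kernel_iso: "(AutoGroup B)\<lparr>carrier := kernel (AutoGroup B) G \<phi>\<rparr>
      \<cong> product_group ?I (\<lambda>i. BijGroup (?C i))"
    using B.automorphisms_fixing_products_iso by simp
  show ?thesis
    by (rule exI[of _ B], rule exI[of _ \<phi>], rule exI[of _ \<psi>], rule exI[of _ ?I], rule exI[of _ ?C])
      (intro conjI ballI kimura_semigroup_inflated_band \<phi>_epi \<psi>_hom \<phi>\<psi> kernel_iso)
qed

end
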